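(* For every ecumenical formula of the form $A^c$ (with $A^i$ its intuitionistic counterpart) and every atomic system $S$, $\neg\neg A^i\Vdash^L_S A^c$.
   Context: Basic setting. Let $\mathsf{At}$ be a countably infinite set of atomic propositions and $\mathsf{At}_\bot=\mathsf{At}\cup\{\bot\}$. An atomic rule has the form "from premises $p_1,\dots,p_n$ ($n\ge 0$) infer $p$", with $p_j,p\in\mathsf{At}_\bot$, where the derivation of each premise may discharge a set of basic sentences. An atomic system $S$ is a set of atomic rules; $S\subseteq S'$ ($S'$ extends $S$) if $S'$ contains all rules of $S$. $\Delta\vdash_S p$ means there is a natural-deduction derivation using only rules of $S$ with conclusion $p$ and undischarged assumptions in $\Delta$ (so $p\vdash_S p$). $S$ is consistent if $\nvdash_S\bot$. Standing convention: all atomic systems (including all extensions quantified over) are required to be consistent. Ecumenical formulas: $p^i,p^c$ for $p\in\mathsf{At}_\bot$; $(A\wedge B)^x,(A\vee B)^x,(A\to B)^x$ for $x\in\{i,c\}$. $A\wedge B$, $A\vee B$, $A\to B$ abbreviate the $i$-versions, $\bot$ denotes $\bot^i$, $\neg A:=(A\to\bot^i)^i$; for $X^c$, $X^i$ is the same construction with outer superscript $i$. Weak validity (by simultaneous recursion): (1) $\Vdash^L_S p^i$ iff $\vdash_S p$ ($p\in\mathsf{At}_\bot$); (2) $\Vdash^L_S p^c$ iff $p\nvdash_S\bot$; (3) for non-atomic $X$, $\Vdash^L_S X^c$ iff $X^i\nVdash^L_S\bot$; (4) $\Vdash^L_S(A\wedge B)^i$ iff $\Vdash^L_S A$ and $\Vdash^L_S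 B$; (5) $\Vdash^L_S(A\to B)^i$ iff $A\Vdash^G_S B$; (6) $\Vdash^L_S(A\vee B)^i$ iff for all $S'\supseteq S$ and all $p\in\mathsf{At}_\bot$, if $A\Vdash^L_{S'}p^i$ and $B\Vdash^L_{S'}p^i$ then $\Vdash^L_{S'}p^i$; (7) for nonempty $\Gamma$, $\Gamma\Vdash^L_S A$ iff for all $S'\supseteq S$, if $\Vdash^L_{S'}B$ for all $B\in\Gamma$ then $\Vdash^L_{S'}A$; (8) $\Gamma\Vdash^G_S A$ iff for all $S'\supseteq S$: if $\Vdash^L_{S''}B$ for all $B\in\Gamma$ and all $S''\supseteq S'$, then $\Vdash^L_{S''}A$ for all $S''\supseteq S'$. *)

theory Defs
  imports Main "HOL-Library.Countable" "HOL-Library.Infinite_Typeclass"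
begin

datatype 'a basic = Atom 'a | Falsum

text \<open>
  The premises of an atomic rule form a list of pairs \<open>(D, q)\<close>, where \<open>D\<close> is the (possibly empty)
  set of basic sentences that may be discharged in the derivation of the premise \<open>q\<close>.
\<close>

datatype 'a atomic_rule =
  Rule "('a basic set \<times> 'a basic) list" "'a basic"

type_synonym 'a atomic_system = "'a atomic_rule set"

inductive derives :: "'a atomic_system \<Rightarrow> 'a basic set \<Rightarrow> 'a basic \<Rightarrow> bool"
  for S :: "'a atomic_system"
where
  assumption: "p \<in> \<Delta> \<Longrightarrow> derives S \<Delta> p"
| rule: "\<lbrakk>Rule ps p \<in> S; \<And>D q. (D, q) \<in> set ps \<Longrightarrow> derives S (\<Delta> \<union> D) q\<rbrakk> \<Longrightarrow> derives S \<Delta> p"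

definition consistent :: "'a atomic_system \<Rightarrow> bool" where
  "consistent S \<longleftrightarrow> \<not> derives S {} Falsum"

text \<open>
  Atomic systems are always required to be consistent, so quantification over the extensions of
  a system means quantification over its consistent extensions.
\<close>

definition extensions :: "'a atomic_system \<Rightarrow> 'a atomic_system set" where
  "extensions S = {S'. S \<subseteq> S' \<and> consistent S'}"

datatype superscript = I | C

text \<open>
  \<open>Fm X x\<close> is the formula \<open>X\<^sup>x\<close>: a construction \<open>X\<close> together with its outer superscript.
\<close>

datatype 'a formula = Fm "'a construction" superscript
and 'a construction =
    Basic "'a basic"
  | And "'a formula" "'a formula"
  | Or "'a formula" "'a formula"
  | Imp "'a formula" "'a formula"

abbreviation bot_i :: "'a formula" where
  "bot_i \<equiv> Fm (Basic Falsum) I"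

abbreviation neg :: "'a formula \<Rightarrow> 'a formula" where
  "neg A \<equiv> Fm (Imp A bot_i) I"

text \<open>
  The two consequence relations are defined relative to a notion \<open>V\<close> of validity in a system;
  they are instantiated with weak validity itself, within its recursive definition.
\<close>

definition local_conseq ::
  "('a atomic_system \<Rightarrow> 'a formula \<Rightarrow> bool) \<Rightarrow>
   'a formula set \<Rightarrow> 'a atomic_system \<Rightarrow> 'a formula \<Rightarrow> bool" where
  "local_conseq V \<Gamma> S A \<longleftrightarrow>
     (if \<Gamma> = {} then V S A
      else (\<forall>S' \<in> extensions S. (\<forall>B \<in> \<Gamma>. V S' B) \<longrightarrow> V S' A))"

definition global_conseq ::
  "('a atomic_system \<Rightarrow> 'a formula \<Rightarrow> bool) \<Rightarrow>
   'a formula set \<Rightarrow> 'a atomic_system \<Rightarrow> 'a formula \<Rightarrow> bool" where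
  "global_conseq V \<Gamma> S A \<longleftrightarrow>
     (\<forall>S' \<in> extensions S.
        (\<forall>B \<in> \<Gamma>. \<forall>S'' \<in> extensions S'. V S'' B) \<longrightarrow> (\<forall>S'' \<in> extensions S'. V S'' A))"

lemma local_conseq_cong [fundef_cong]:
  assumes "\<Gamma> = \<Gamma>'" "S = S'" "A = A'"
    and "\<And>T B. B \<in> insert A' \<Gamma>' \<Longrightarrow> V T B = V' T B"
  shows "local_conseq V \<Gamma> S A = local_conseq V' \<Gamma>' S' A'"
  using assms by (auto simp: local_conseq_def)

lemma global_conseq_cong [fundef_cong]:
  assumes "\<Gamma> = \<Gamma>'" "S = S'" "A = A'"
    and "\<And>T B. B \<in> insert A' \<Gamma>' \<Longrightarrow> V T B = V' T B"
  shows "global_conseq V \<Gamma> S A = global_conseq V' \<Gamma>' S' A'"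
  using assms by (simp add: global_conseq_def)

primrec rank :: "'a formula \<Rightarrow> nat" and rank_construction :: "'a construction \<Rightarrow> nat" where
  "rank (Fm X x) = 2 * rank_construction X + (case x of I \<Rightarrow> 0 | C \<Rightarrow> 1)"
| "rank_construction (Basic p) = 0"
| "rank_construction (And A B) = Suc (rank A + rank B)"
| "rank_construction (Or A B) = Suc (rank A + rank B)"
| "rank_construction (Imp A B) = Suc (rank A + rank B)"

function (sequential) weakly_valid :: "'a atomic_system \<Rightarrow> 'a formula \<Rightarrow> bool" where
  "weakly_valid S (Fm (Basic p) I) \<longleftrightarrow> derives S {} p"
| "weakly_valid S (Fm (Basic p) C) \<longleftrightarrow> \<not> derives S {p} Falsum"
| "weakly_valid S (Fm (And A B) I) \<longleftrightarrow> weakly_valid S A \<and> weakly_valid S B"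
| "weakly_valid S (Fm (Imp A B) I) \<longleftrightarrow> global_conseq weakly_valid {A} S B"
| "weakly_valid S (Fm (Or A B) I) \<longleftrightarrow>
     (\<forall>S' \<in> extensions S. \<forall>p.
        local_conseq weakly_valid {A} S' (Fm (Basic p) I) \<longrightarrow>
        local_conseq weakly_valid {B} S' (Fm (Basic p) I) \<longrightarrow>
        weakly_valid S' (Fm (Basic p) I))"
| "weakly_valid S (Fm X C) \<longleftrightarrow> \<not> local_conseq weakly_valid {Fm X I} S bot_i"
  by pat_completeness auto
termination
  by (relation "measure (\<lambda>(S, A). rank A)") (auto split: superscript.splits)

abbreviation weak_local_conseq ::
  "'a formula set \<Rightarrow> 'a atomic_system \<Rightarrow> 'a formula \<Rightarrow> bool"
  ("_ \<tturnstile>\<^sup>L\<^bsub>_\<^esub> _" [51, 0, 51] 50) where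
  "\<Gamma> \<tturnstile>\<^sup>L\<^bsub>S\<^esub> A \<equiv> local_conseq weakly_valid \<Gamma> S A"

end

theory Submission imports Defs begin

text \<open>
  If \<open>\<not>\<not>A\<^sup>i\<close> is valid in a consistent system, some consistent extension validates \<open>A\<^sup>i\<close>.
  For non-atomic \<open>A\<close> that is the meaning of \<open>A\<^sup>c\<close>. For an atom \<open>p\<close>, a derivation of \<open>\<bottom>\<close> from \<open>p\<close>
  would survive in that extension, and cutting it with the derivation of \<open>p\<close> would make
  the extension inconsistent.
\<close>

lemma derives_mono:
  assumes "derives S \<Gamma> p" "S \<subseteq> T" "\<Gamma> \<subseteq> \<Delta>"
  shows "derives T \<Delta> p"
  using assms
proof (induction arbitrary: \<Delta> rule: derives.induct)
  case (assumption p \<Gamma>)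
  then show ?case by (auto intro: derives.assumption)
next
  case (rule ps p \<Gamma>)
  have "Rule ps p \<in> T"
    using rule.hyps(1) rule.prems(1) by blast
  moreover have "derives T (\<Delta> \<union> D) q" if "(D, q) \<in> set ps" for D q
    using rule.IH[OF that rule.prems(1)] rule.prems(2) by blast
  ultimately show ?case by (rule derives.rule)
qed

lemma derives_cut:
  assumes "derives S \<Gamma> q" "\<And>p. p \<in> \<Gamma> \<Longrightarrow> derives S \<Delta> p"
  shows "derives S \<Delta> q"
  using assms
proof (induction arbitrary: \<Delta> rule: derives.induct)
  case (assumption p \<Gamma>)
  then show ?case by blast
next
  case (rule ps p \<Gamma>)
  have "derives S (\<Delta> \<union> D) q" if "(D, q) \<in> set ps" for D q
  proof (rule rule.IH[OF that])
    fix r assume "r \<in> \<Gamma> \<union> D"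
    \<comment> \<open>A sentence in \<open>D\<close> is an assumption; for one in
      \<open>\<Gamma>\<close>, the given derivation from \<open>\<Delta>\<close> is
      weakened.\<close>
    then show "derives S (\<Delta> \<union> D) r"
      using rule.prems by (auto intro: derives.assumption derives_mono)
  qed
  with rule.hyps(1) show ?case by (rule derives.rule)
qed

lemma extensions_refl: "consistent S \<Longrightarrow> S \<in> extensions S"
  by (simp add: extensions_def)

lemma extensions_trans: "T \<in> extensions S \<Longrightarrow> U \<in> extensions T \<Longrightarrow> U \<in> extensions S"
  by (auto simp: extensions_def)

lemma consistent_extension: "T \<in> extensions S \<Longrightarrow> consistent T"
  by (simp add: extensions_def)

text \<open>Since \<open>T\<close> is consistent and belongs to \<open>extensions T\<close>,
  \<open>bot_i\<close> cannot hold throughout \<open>extensions T\<close>. The implication defining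
  the negation therefore forces its premise to fail.\<close>

lemma weakly_valid_neg_iff:
  "weakly_valid S (neg A) \<longleftrightarrow> (\<forall>T \<in> extensions S. \<exists>U \<in> extensions T. \<not> weakly_valid U A)"
proof -
  have "\<not> (\<forall>U \<in> extensions T. derives U {} Falsum)" if "T \<in> extensions S" for T
    using extensions_refl consistent_extension[OF that] unfolding consistent_def by blast
  then show ?thesis
    by (auto simp: global_conseq_def)
qed

text \<open>The outer negation, read at \<open>S\<close> itself, yields \<open>T\<close> refuting
  \<open>neg A\<close>. That refutation yields \<open>U\<close> above \<open>T\<close> whose
  extensions all validate \<open>A\<close>, and \<open>U\<close> is one of them.\<close>

lemma weakly_valid_neg_neg_obtains:
  assumes "consistent S" "weakly_valid S (neg (neg A))"
  obtains U where "U \<in> extensions S" "weakly_valid U A"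
proof -
  obtain T where T: "T \<in> extensions S" "\<not> weakly_valid T (neg A)"
    using assms extensions_refl unfolding weakly_valid_neg_iff[of S] by blast
  then obtain U where U: "U \<in> extensions T" "\<forall>V \<in> extensions U. weakly_valid V A"
    unfolding weakly_valid_neg_iff by blast
  have "weakly_valid U A"
    using U extensions_refl consistent_extension by blast
  with T(1) U(1) show ?thesis
    using that extensions_trans by blast
qed

lemma weakly_valid_C_if_extension:
  assumes U: "U \<in> extensions S" and valid: "weakly_valid U (Fm X I)"
  shows "weakly_valid S (Fm X C)"
proof (cases "\<exists>p. X = Basic p")
  case True
  then obtain p where X: "X = Basic p" by blast
  have "\<not> derives S {p} Falsum"
  proof
    assume "derives S {p} Falsum"
    then have "derives U {p} Falsum"
      using U by (auto simp: extensions_def intro: derives_mono)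
    then have "derives U {} Falsum"
      by (rule derives_cut) (use valid X in simp)
    with consistent_extension[OF U] show False
      by (simp add: consistent_def)
  qed
  with X show ?thesis by simp
next
  case False
  \<comment> \<open>\<open>U\<close> is the counterexample: it validates \<open>Fm X I\<close> but,
    being consistent, not \<open>bot_i\<close>.\<close>
  have "\<not> local_conseq weakly_valid {Fm X I} S bot_i"
    using U valid consistent_extension[OF U]
    by (auto simp: local_conseq_def consistent_def simp del: weakly_valid.simps(2-))
  \<comment> \<open>Sequential pattern matching splits the last clause of
    \<open>weakly_valid\<close> into one equation per compound constructor.\<close>
  with False show ?thesis by (cases X) simp_all
qed

theorem theorem7:
  fixes A :: "'a::{countable, infinite} construction" and S :: "'a atomic_system"
  assumes "consistent S"
  shows "{neg (neg (Fm A I))} \<tturnstile>\<^sup>L\<^bsub>S\<^esub> Fm A C"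
proof -
  \<comment> \<open>Both lemmas are applied at \<open>T\<close>, so the witnessing extension lies
    above \<open>T\<close>.\<close>
  have "weakly_valid T (Fm A C)"
    if T: "T \<in> extensions S" and nn: "weakly_valid T (neg (neg (Fm A I)))" for T
    using weakly_valid_neg_neg_obtains[OF consistent_extension[OF T] nn]
      weakly_valid_C_if_extension by blast
  then show ?thesis
    unfolding local_conseq_def by simp
qed

end
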